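(* The convergence exponent $\lambda^* \colon [0,1] \to [0,1]$ of Pierce expansion digit sequences vanishes Lebesgue-almost everywhere, i.e., $\lambda^*(x) = 0$ for Lebesgue-almost every $x \in [0,1]$.
   Context: Pierce digits. For $x \in [0,1]$, define $d_1(x) := \lfloor 1/x \rfloor$ and $T(x) := 1 - d_1(x)\,x$ if $x \neq 0$, and $d_1(0) := \infty$, $T(0) := 0$. Here $\lfloor y \rfloor$ is the largest integer not exceeding $y$. For $n \in \mathbb{N} = \{1,2,3,\dots\}$ put $d_n(x) := d_1(T^{n-1}(x))$, where $T^{n-1}$ is the $(n-1)$-fold iterate of $T$ ($T^0$ is the identity). The sequence $(d_n(x))_{n \in \mathbb{N}}$ is the Pierce expansion digit sequence of $x$. Conventions: $\infty^s := \infty$ for $s>0$ and $c/\infty := 0$ for $c \in \mathbb{R}$. Convergence exponent: for $x \in [0,1]$, $\lambda^*(x) := \inf\{ s > 0 : \sum_{n \in \mathbb{N}} 1/(d_n(x))^s \text{ converges} \}$. The function $\lambda^*$ takes values in $[0,1]$. *)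

theory Defs
  imports "HOL-Analysis.Analysis"
begin

text \<open>
  The functions below are meant for arguments in \<open>[0,1]\<close>; there \<open>\<lfloor>1/x\<rfloor> \<ge> 1\<close> for \<open>x \<noteq> 0\<close>,
  so that the truncation by \<open>nat\<close> has no effect.
\<close>

definition pierce_d1 :: "real \<Rightarrow> enat" where
  "pierce_d1 x = (if x = 0 then \<infinity> else enat (nat \<lfloor>1 / x\<rfloor>))"

definition pierce_T :: "real \<Rightarrow> real" where
  "pierce_T x = (if x = 0 then 0 else 1 - of_int \<lfloor>1 / x\<rfloor> * x)"

text \<open>Digits are numbered from \<open>n = 1\<close>; the value at \<open>n = 0\<close> is irrelevant.\<close>

definition pierce_digit :: "nat \<Rightarrow> real \<Rightarrow> enat" where
  "pierce_digit n x = pierce_d1 ((pierce_T ^^ (n - 1)) x)"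

text \<open>Only used for \<open>s > 0\<close>, where \<open>\<infinity>\<close> to the power \<open>s\<close> is \<open>\<infinity>\<close>.\<close>

definition enat_powr :: "enat \<Rightarrow> real \<Rightarrow> ereal" where
  "enat_powr d s = (case d of enat k \<Rightarrow> ereal (real k powr s) | \<infinity> \<Rightarrow> \<infinity>)"

text \<open>
  On \<open>ereal\<close> one has \<open>1 / \<infinity> = 0\<close>, and every digit of \<open>x \<in> [0,1]\<close> is at least 1, so all terms are
  finite and \<open>real_of_ereal\<close> loses nothing. Taking the infimum in \<open>ereal\<close> gives it its usual meaning
  without presupposing that the set is nonempty.
\<close>

definition pierce_conv_exp :: "real \<Rightarrow> ereal" where
  "pierce_conv_exp x =
     Inf {ereal s |s. s > 0 \<and>
       summable (\<lambda>n. real_of_ereal (1 / enat_powr (pierce_digit (Suc n) x) s))}"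

end

theory Submission
  imports Defs
begin

text \<open>
  Each branch \<open>{x. \<lfloor>1 / x\<rfloor> = j} = (1 / (j + 1), 1 / j]\<close> of the Pierce map is affine and has an interval
  with end points \<open>0\<close> and \<open>1 / (j + 1)\<close> as its image. So if \<open>x\<close> is uniformly distributed in the branch,
  then \<open>pierce_T x\<close> is uniformly distributed in \<open>(0, 1 / (j + 1))\<close>, with a mean of only half the left
  end point of the branch. Hence a step of the orbit at least halves the mean, and the \<open>n\<close>-th iterate
  has mean at most \<open>2\<^sup>-\<^sup>n\<close> (\<open>nn_integral_pierce_T_funpow_le\<close>). Since \<open>\<Sum>n. (3/2)\<^sup>n 2\<^sup>-\<^sup>n\<close> converges, for
  almost every \<open>x\<close> the series \<open>\<Sum>n. (3/2)\<^sup>n (pierce_T ^^ n) x\<close> converges, so that the orbit decays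
  exponentially (\<open>AE_pierce_T_funpow_le\<close>).

  The reciprocal of a digit is at most twice the point of the orbit that it comes from. Therefore the
  digits of almost every \<open>x\<close> grow exponentially, and \<open>\<Sum>n. d\<^sub>n powr - s\<close> is dominated by a
  geometric series for every \<open>s > 0\<close> (\<open>pierce_conv_exp_eq_0\<close>). For an arbitrary \<open>x\<close>, the
  strict growth of the digits still bounds the \<open>n\<close>-th iterate by \<open>1 / (n + 1)\<close>, and
  \<open>\<Sum>n. (n + 1) powr - s\<close> converges for \<open>s > 1\<close> (\<open>pierce_conv_exp_le_1\<close>).
\<close>

section \<open>The Pierce map on the unit interval\<close>

lemma pierce_T_0 [simp]: "pierce_T 0 = 0"
  by (simp add: pierce_T_def)

lemma pierce_T_funpow_0 [simp]: "(pierce_T ^^ n) 0 = 0"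
  by (induction n) auto

lemma measurable_pierce_T [measurable]: "pierce_T \<in> borel_measurable borel"
  unfolding pierce_T_def by measurable

lemma measurable_pierce_T_funpow [measurable]: "pierce_T ^^ n \<in> borel_measurable borel"
  by (induction n) (auto intro: measurable_comp)

lemma pierce_T_eq_on_branch:
  assumes "j > 0" "x \<in> {1 / (real j + 1) <.. 1 / real j}"
  shows   "pierce_T x = 1 - real j * x"
proof -
  have "x > 0"
    using assms by (auto intro: less_trans[rotated])
  hence "\<lfloor>1 / x\<rfloor> = int j"
    using assms by (intro floor_unique) (auto simp: field_simps)
  thus ?thesis
    using \<open>x > 0\<close> by (simp add: pierce_T_def)
qed

lemma pierce_T_bounds:
  assumes "m > 0" "x \<in> {0..1 / real m}"
  shows   "pierce_T x \<in> {0..1 / (real m + 1)}"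
proof (cases "x = 0")
  case False
  define k where "k = \<lfloor>1 / x\<rfloor>"
  from False assms have x: "x > 0" "x \<le> 1 / real m" by auto
  hence "real m \<le> 1 / x"
    using assms by (simp add: field_simps)
  hence "int m \<le> k"
    unfolding k_def by (simp add: le_floor_iff)
  hence mk: "real m \<le> of_int k"
    by linarith
  have k: "of_int k \<le> 1 / x" "1 / x < of_int k + 1"
    unfolding k_def by linarith+
  from k x have 1: "of_int k * x \<le> 1" "1 < of_int k * x + x"
    by (auto simp: field_simps)
  have "(1 - of_int k * x) * (real m + 1) \<le> (1 - of_int k * x) * (of_int k + 1)"
    using mk 1 by (intro mult_left_mono) auto
  also have "\<dots> = 1 - of_int k * (of_int k * x + x - 1)"
    by (simp add: algebra_simps)
  also have "\<dots> \<le> 1"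
    using 1 mk by simp
  finally show ?thesis
    using 1 False unfolding pierce_T_def k_def by (simp add: field_simps)
qed (auto simp: pierce_T_def)

text \<open>
  This is the bound \<open>d\<^sub>n \<ge> n\<close>, coming from the strict growth of the digits, in terms of the orbit.
\<close>
lemma pierce_T_funpow_bounds:
  assumes "x \<in> {0..1}"
  shows   "(pierce_T ^^ n) x \<in> {0..1 / (real n + 1)}"
proof (induction n)
  case (Suc n)
  thus ?case
    using pierce_T_bounds[of "Suc n" "(pierce_T ^^ n) x"] by (simp add: add_ac)
qed (use assms in auto)

section \<open>Convergence exponents from upper bounds for the orbit\<close>

text \<open>
  As the first digit \<open>k\<close> of \<open>y \<noteq> 0\<close> satisfies \<open>1 / y < k + 1 \<le> 2 k\<close>, reciprocals of digits can be
  replaced by points of the orbit.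
\<close>
lemma inverse_pierce_d1_powr_le:
  assumes "y \<in> {0..1}" "s > 0"
  shows   "real_of_ereal (1 / enat_powr (pierce_d1 y) s) \<in> {0..(2 * y) powr s}"
proof (cases "y = 0")
  case False
  define k where "k = nat \<lfloor>1 / y\<rfloor>"
  from False assms have y: "y > 0" "y \<le> 1" by auto
  hence "1 \<le> \<lfloor>1 / y\<rfloor>"
    by (simp add: le_floor_iff)
  hence k: "real k \<ge> 1" "1 / y < real k + 1"
    unfolding k_def by linarith+
  have "1 / real k \<le> 2 * y"
  proof -
    have "1 < y * (real k + 1)" using k y by (simp add: field_simps)
    also have "\<dots> \<le> y * (2 * real k)" using k y by (intro mult_left_mono) auto
    finally show ?thesis using k by (simp add: field_simps)
  qed
  hence "(1 / real k) powr s \<le> (2 * y) powr s"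
    using assms by (intro powr_mono2) auto
  moreover have "(1 / real k) powr s = 1 / real k powr s"
    using k by (simp add: powr_divide)
  moreover have "real_of_ereal (1 / enat_powr (pierce_d1 y) s) = 1 / real k powr s"
    using False k by (simp add: pierce_d1_def enat_powr_def k_def[symmetric] one_ereal_def)
  ultimately show ?thesis by auto
qed (auto simp: pierce_d1_def enat_powr_def)

lemma pierce_conv_exp_nonneg: "0 \<le> pierce_conv_exp x"
  unfolding pierce_conv_exp_def by (rule Inf_greatest) auto

lemma pierce_conv_exp_le:
  assumes x: "x \<in> {0..1}" and "c \<ge> 0"
  assumes b: "\<And>n. (pierce_T ^^ n) x \<le> b n"
  assumes summable: "\<And>s. s > c \<Longrightarrow> summable (\<lambda>n. (2 * b n) powr s)"
  shows   "pierce_conv_exp x \<le> ereal c"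
proof (rule ereal_le_epsilon2)
  fix e :: real assume e: "e > 0"
  define s where "s = c + e"
  have s: "s > 0" "s > c" using e \<open>c \<ge> 0\<close> by (auto simp: s_def)
  have "summable (\<lambda>n. real_of_ereal (1 / enat_powr (pierce_digit (Suc n) x) s))"
  proof (rule summable_comparison_test'[OF summable[OF \<open>s > c\<close>]])
    fix n :: nat
    define y where "y = (pierce_T ^^ n) x"
    have "y \<in> {0..1 / (real n + 1)}"
      unfolding y_def by (rule pierce_T_funpow_bounds[OF x])
    moreover have "1 / (real n + 1) \<le> 1" by simp
    ultimately have y: "y \<in> {0..1}" by (auto intro: order_trans)
    have "real_of_ereal (1 / enat_powr (pierce_digit (Suc n) x) s) \<in> {0..(2 * y) powr s}"
      using inverse_pierce_d1_powr_le[OF y s(1)] by (simp add: pierce_digit_def y_def)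
    moreover have "(2 * y) powr s \<le> (2 * b n) powr s"
      using y b[of n] s by (intro powr_mono2) (auto simp: y_def)
    ultimately show "norm (real_of_ereal (1 / enat_powr (pierce_digit (Suc n) x) s))
                       \<le> (2 * b n) powr s"
      unfolding real_norm_def by (subst abs_of_nonneg) auto
  qed
  hence "pierce_conv_exp x \<le> ereal s"
    unfolding pierce_conv_exp_def using s by (intro Inf_lower) auto
  thus "pierce_conv_exp x \<le> ereal c + ereal e" by (simp add: s_def)
qed

lemma pierce_conv_exp_le_1:
  assumes "x \<in> {0..1}"
  shows   "pierce_conv_exp x \<le> 1"
  unfolding one_ereal_def
proof (rule pierce_conv_exp_le[OF assms])
  show "(pierce_T ^^ n) x \<le> 1 / (real n + 1)" for n
    using pierce_T_funpow_bounds[OF assms, of n] by simp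
  fix s :: real assume "s > 1"
  hence "summable (\<lambda>n. 2 powr s * real (n + 1) powr - s)"
    using summable_real_powr_iff[of "-s"]
    by (intro summable_mult) (subst summable_iff_shift, auto)
  also have "(\<lambda>n. 2 powr s * real (n + 1) powr - s) = (\<lambda>n. (2 * (1 / (real n + 1))) powr s)"
    by (simp add: powr_divide powr_minus field_simps)
  finally show "summable (\<lambda>n. (2 * (1 / (real n + 1))) powr s)" .
qed auto

lemma pierce_conv_exp_eq_0:
  assumes x: "x \<in> {0..1}" and r: "0 < r" "r < 1"
  assumes b: "\<And>n. (pierce_T ^^ n) x \<le> C * r ^ n"
  shows   "pierce_conv_exp x = 0"
proof -
  have C: "C \<ge> 0"
    using b[of 0] x by simp
  have "pierce_conv_exp x \<le> ereal 0"
  proof (rule pierce_conv_exp_le[OF x _ b])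
    fix s :: real assume s: "s > 0"
    have "r powr s < 1"
      using r s powr_less_mono2[of s r 1] by simp
    hence "summable (\<lambda>n. (2 * C) powr s * (r powr s) ^ n)"
      by (intro summable_mult summable_geometric) auto
    also have "(\<lambda>n. (2 * C) powr s * (r powr s) ^ n) = (\<lambda>n. (2 * (C * r ^ n)) powr s)"
      using r C by (simp add: powr_mult powr_powr mult_ac flip: powr_realpow)
    finally show "summable (\<lambda>n. (2 * (C * r ^ n)) powr s)" .
  qed auto
  thus ?thesis
    using pierce_conv_exp_nonneg[of x] by (simp add: zero_ereal_def)
qed

section \<open>The mean of the orbit\<close>

lemma Un_pierce_branches:
  assumes "m > 0"
  shows   "{0 <.. 1 / real m} = (\<Union>i. {1 / (real (m + i) + 1) <.. 1 / real (m + i)})"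
proof (intro equalityI subsetI)
  fix x assume x: "x \<in> {0 <.. 1 / real m}"
  hence "real m \<le> 1 / x"
    using assms by (auto simp: field_simps)
  hence m: "int m \<le> \<lfloor>1 / x\<rfloor>"
    by (simp add: le_floor_iff)
  define i where "i = nat \<lfloor>1 / x\<rfloor> - m"
  have "real (m + i) \<le> 1 / x" "1 / x < real (m + i) + 1"
    using m unfolding i_def by linarith+
  hence "x \<in> {1 / (real (m + i) + 1) <.. 1 / real (m + i)}"
    using x assms by (auto simp: field_simps)
  thus "x \<in> (\<Union>i. {1 / (real (m + i) + 1) <.. 1 / real (m + i)})" by blast
next
  fix x assume "x \<in> (\<Union>i. {1 / (real (m + i) + 1) <.. 1 / real (m + i)})"
  then obtain i where i: "1 / (real (m + i) + 1) < x" "x \<le> 1 / real (m + i)" by auto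
  have "0 < 1 / (real (m + i) + 1)" by simp
  also note i(1)
  finally have "0 < x" .
  have "1 / real (m + i) \<le> 1 / real m"
    using assms by (intro divide_left_mono) auto
  with i \<open>0 < x\<close> show "x \<in> {0 <.. 1 / real m}" by auto
qed

lemma disjoint_family_pierce_branches:
  assumes "m > 0"
  shows   "disjoint_family (\<lambda>i. {1 / (real (m + i) + 1) <.. 1 / real (m + i)})"
proof -
  have "{1 / (real (m + i) + 1) <.. 1 / real (m + i)} \<inter> {1 / (real (m + j) + 1) <.. 1 / real (m + j)} = {}"
    if "i < j" for i j
  proof -
    have "1 / real (m + j) \<le> 1 / (real (m + i) + 1)"
      using that assms by (intro divide_left_mono) auto
    thus ?thesis by auto
  qed
  thus ?thesis
    unfolding disjoint_family_on_def by (metis inf_commute nat_neq_iff)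
qed

text \<open>
  The branch of \<open>pierce_T\<close> with first digit \<open>j\<close> is affine with slope \<open>- j\<close> and maps onto an interval
  starting at \<open>0\<close>: this is what makes the process of digits a Markov chain.
\<close>
lemma nn_integral_pierce_branch:
  fixes g :: "real \<Rightarrow> ennreal"
  assumes [measurable]: "g \<in> borel_measurable borel" and "j > 0"
  shows "(\<integral>\<^sup>+x\<in>{1 / (real j + 1) <.. 1 / real j}. g (pierce_T x) \<partial>lborel) =
         ennreal (1 / real j) * (\<integral>\<^sup>+y\<in>{0 ..< 1 / (real j + 1)}. g y \<partial>lborel)"
proof -
  have "(\<integral>\<^sup>+x\<in>{1 / (real j + 1) <.. 1 / real j}. g (pierce_T x) \<partial>lborel) =
        (\<integral>\<^sup>+x\<in>{1 / (real j + 1) <.. 1 / real j}. g (1 - real j * x) \<partial>lborel)"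
    using pierce_T_eq_on_branch[OF \<open>j > 0\<close>]
    by (intro nn_integral_cong) (auto simp: indicator_def)
  also have "\<dots> = ennreal \<bar>- 1 / real j\<bar> *
      (\<integral>\<^sup>+y. g (1 - real j * (1 / real j + (- 1 / real j) * y)) *
         indicator {1 / (real j + 1) <.. 1 / real j} (1 / real j + (- 1 / real j) * y) \<partial>lborel)"
    using \<open>j > 0\<close> by (intro nn_integral_real_affine) auto
  also have "(\<lambda>y. g (1 - real j * (1 / real j + (- 1 / real j) * y)) *
         indicator {1 / (real j + 1) <.. 1 / real j} (1 / real j + (- 1 / real j) * y)) =
      (\<lambda>y. g y * indicator {0 ..< 1 / (real j + 1)} y)"
    using \<open>j > 0\<close> by (intro ext) (auto simp: indicator_def field_simps zero_le_mult_iff)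
  finally show ?thesis by simp
qed

lemma pierce_telescoping_sum:
  assumes "m > 0"
  shows "(\<Sum>i. ennreal (1 / (real (m + i) * (real (m + i) + 1)\<^sup>2))) \<le> ennreal (1 / 2 / (real m)\<^sup>2)"
proof -
  define f where "f = (\<lambda>i. 1 / 2 / (real (m + i))\<^sup>2)"
  have "f \<longlonglongrightarrow> 0"
    unfolding f_def by real_asymp
  hence sums: "(\<lambda>i. f i - f (Suc i)) sums (f 0 - 0)"
    by (rule telescope_sums')
  have le: "1 / (real (m + i) * (real (m + i) + 1)\<^sup>2) \<le> f i - f (Suc i)" for i
  proof -
    have *: "1 / (t * (t + 1)\<^sup>2) \<le> 1 / 2 / t\<^sup>2 - 1 / 2 / (t + 1)\<^sup>2" if "t > 0" for t :: real
    proof -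
      have "1 / 2 / t\<^sup>2 - 1 / 2 / (t + 1)\<^sup>2 - 1 / (t * (t + 1)\<^sup>2) = 1 / (2 * t\<^sup>2 * (t + 1)\<^sup>2)"
        using that by (simp add: divide_simps) (simp add: algebra_simps power2_eq_square)
      moreover have "\<dots> \<ge> 0" by simp
      ultimately show ?thesis by linarith
    qed
    show ?thesis
      using *[of "real (m + i)"] assms by (simp add: f_def add_ac)
  qed
  have "(\<Sum>i. ennreal (1 / (real (m + i) * (real (m + i) + 1)\<^sup>2))) \<le> (\<Sum>i. ennreal (f i - f (Suc i)))"
    by (intro suminf_le ennreal_leI le) auto
  also have "\<dots> = ennreal (f 0)"
  proof (intro suminf_ennreal_eq)
    show "0 \<le> f i - f (Suc i)" for i
      by (rule order_trans[OF _ le]) simp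
  qed (use sums in simp)
  finally show ?thesis by (simp add: f_def)
qed

text \<open>
  The induction on \<open>n\<close> goes through all intervals \<open>(0, 1/m]\<close> at once, because the first step moves the
  uniform distribution on a branch to the one on such an interval, with \<open>m = j + 1\<close>. The factor \<open>1/2\<close>
  arises as follows: by the induction hypothesis, the mean over this branch is at most
  \<open>(1/2)\<^sup>n / (j + 1)\<close>; here \<open>1 / (j + 1)\<close> is the left end point of the branch and so less than \<open>x\<close>,
  whose mean over \<open>(0, 1/m]\<close> is \<open>1 / (2 m)\<close>. In the proof this last estimate is the telescoping sum
  above.
\<close>
lemma nn_integral_pierce_T_funpow_le:
  assumes "m > 0"
  shows "(\<integral>\<^sup>+x\<in>{0 <.. 1 / real m}. ennreal ((pierce_T ^^ n) x) \<partial>lborel)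
           \<le> ennreal ((1 / 2) ^ n / (real m)\<^sup>2)"
  using assms
proof (induction n arbitrary: m)
  case 0
  have "(\<integral>\<^sup>+x\<in>{0 <.. 1 / real m}. ennreal ((pierce_T ^^ 0) x) \<partial>lborel) \<le>
        (\<integral>\<^sup>+x. ennreal (1 / real m) * indicator {0 <.. 1 / real m} x \<partial>lborel)"
    by (intro nn_integral_mono) (auto simp: indicator_def intro: ennreal_leI)
  also have "\<dots> = ennreal (1 / real m) * ennreal (1 / real m)"
    by (subst nn_integral_cmult_indicator) auto
  also have "\<dots> = ennreal ((1 / 2) ^ 0 / (real m)\<^sup>2)"
    by (simp add: power2_eq_square flip: ennreal_mult)
  finally show ?case .
next
  case (Suc n)
  define I where "I = (\<lambda>i. {1 / (real (m + i) + 1) <.. 1 / real (m + i)})"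
  define g where "g = (\<lambda>x. ennreal ((pierce_T ^^ n) x))"
  have [measurable]: "g \<in> borel_measurable borel" "I i \<in> sets borel" for i
    by (auto simp: g_def I_def)
  have "(\<integral>\<^sup>+x\<in>{0 <.. 1 / real m}. ennreal ((pierce_T ^^ Suc n) x) \<partial>lborel) =
        (\<integral>\<^sup>+x\<in>(\<Union>i. I i). g (pierce_T x) \<partial>lborel)"
    using Un_pierce_branches[OF Suc.prems] by (simp add: g_def I_def funpow_swap1)
  also have "\<dots> = (\<Sum>i. \<integral>\<^sup>+x\<in>I i. g (pierce_T x) \<partial>lborel)"
    using disjoint_family_pierce_branches[OF Suc.prems]
    by (intro nn_integral_disjoint_family) (auto simp: I_def)
  also have "\<dots> \<le> (\<Sum>i. ennreal ((1 / 2) ^ n) *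
                     ennreal (1 / (real (m + i) * (real (m + i) + 1)\<^sup>2)))"
  proof (intro suminf_le)
    fix i
    define j where "j = m + i"
    have "(\<integral>\<^sup>+x\<in>I i. g (pierce_T x) \<partial>lborel) =
          ennreal (1 / real j) * (\<integral>\<^sup>+y\<in>{0 ..< 1 / (real j + 1)}. g y \<partial>lborel)"
      unfolding I_def j_def using Suc.prems by (intro nn_integral_pierce_branch) auto
    also have "(\<integral>\<^sup>+y\<in>{0 ..< 1 / (real j + 1)}. g y \<partial>lborel) \<le>
               (\<integral>\<^sup>+y\<in>{0 <.. 1 / real (Suc j)}. g y \<partial>lborel)"
    proof (intro nn_integral_mono)
      \<comment> \<open>At the additional point \<open>y = 0\<close> the integrand vanishes.\<close>
      fix y :: real
      show "g y * indicator {0 ..< 1 / (real j + 1)} y \<le> g y * indicator {0 <.. 1 / real (Suc j)} y"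
        by (cases "y = 0") (auto simp: g_def indicator_def add_ac)
    qed
    also have "\<dots> \<le> ennreal ((1 / 2) ^ n / (real (Suc j))\<^sup>2)"
      unfolding g_def by (rule Suc.IH) auto
    also have "ennreal (1 / real j) * \<dots> = ennreal ((1 / 2) ^ n) * ennreal (1 / (real j * (real j + 1)\<^sup>2))"
      by (simp add: add_ac flip: ennreal_mult)
    finally show "(\<integral>\<^sup>+x\<in>I i. g (pierce_T x) \<partial>lborel) \<le>
        ennreal ((1 / 2) ^ n) * ennreal (1 / (real (m + i) * (real (m + i) + 1)\<^sup>2))"
      by (simp add: j_def mult_left_mono)
  qed auto
  also have "\<dots> = ennreal ((1 / 2) ^ n) * (\<Sum>i. ennreal (1 / (real (m + i) * (real (m + i) + 1)\<^sup>2)))"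
    by (rule ennreal_suminf_cmult)
  also have "\<dots> \<le> ennreal ((1 / 2) ^ n) * ennreal (1 / 2 / (real m)\<^sup>2)"
    by (intro mult_left_mono pierce_telescoping_sum Suc.prems) auto
  also have "\<dots> = ennreal ((1 / 2) ^ Suc n / (real m)\<^sup>2)"
    by (simp add: field_simps flip: ennreal_mult)
  finally show ?case .
qed

section \<open>Exponential decay of almost every orbit\<close>

text \<open>
  Any rate strictly between \<open>1/2\<close> and \<open>1\<close> would do: weighting the orbit with \<open>(3/2)\<^sup>n\<close> leaves a
  convergent series \<open>\<Sum>n. (3/4)\<^sup>n\<close> of means.
\<close>
lemma AE_pierce_T_funpow_le:
  "AE x in lborel. x \<in> {0..1} \<longrightarrow> (\<exists>C. \<forall>n. (pierce_T ^^ n) x \<le> C * (2 / 3) ^ n)"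
proof -
  define f where
    "f = (\<lambda>n x. ennreal ((3 / 2) ^ n) * (ennreal ((pierce_T ^^ n) x) * indicator {0 <.. 1 :: real} x))"
  have [measurable]: "f n \<in> borel_measurable lborel" for n
    unfolding f_def by measurable
  have "(\<integral>\<^sup>+x. (\<Sum>n. f n x) \<partial>lborel) = (\<Sum>n. \<integral>\<^sup>+x. f n x \<partial>lborel)"
    by (rule nn_integral_suminf) auto
  also have "\<dots> \<le> (\<Sum>n. ennreal ((3 / 4) ^ n))"
  proof (intro suminf_le)
    fix n
    have "(\<integral>\<^sup>+x. f n x \<partial>lborel) = ennreal ((3 / 2) ^ n) *
            (\<integral>\<^sup>+x\<in>{0 <.. 1 / real 1}. ennreal ((pierce_T ^^ n) x) \<partial>lborel)"
      unfolding f_def by (subst nn_integral_cmult) auto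
    also have "\<dots> \<le> ennreal ((3 / 2) ^ n) * ennreal ((1 / 2) ^ n / (real 1)\<^sup>2)"
      by (intro mult_left_mono nn_integral_pierce_T_funpow_le) auto
    also have "\<dots> = ennreal ((3 / 4) ^ n)"
      by (simp flip: ennreal_mult power_mult_distrib)
    finally show "(\<integral>\<^sup>+x. f n x \<partial>lborel) \<le> ennreal ((3 / 4) ^ n)" .
  qed auto
  also have "\<dots> = ennreal 4"
    using geometric_sums[of "3 / 4 :: real"] by (intro suminf_ennreal_eq) auto
  finally have "(\<integral>\<^sup>+x. (\<Sum>n. f n x) \<partial>lborel) \<noteq> \<infinity>"
    by (auto simp: top_unique)
  hence "AE x in lborel. (\<Sum>n. f n x) \<noteq> \<infinity>"
    by (intro nn_integral_noteq_infinite) auto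
  thus ?thesis
  proof eventually_elim
    case (elim x)
    show ?case
    proof
      assume x: "x \<in> {0..1}"
      show "\<exists>C. \<forall>n. (pierce_T ^^ n) x \<le> C * (2 / 3) ^ n"
      proof (cases "x = 0")
        case True
        thus ?thesis by (intro exI[of _ 0]) auto
      next
        case False
        from elim obtain C where C: "C \<ge> 0" "(\<Sum>n. f n x) = ennreal C"
          by (cases "\<Sum>n. f n x") (auto simp: infinity_ennreal_def)
        have "(pierce_T ^^ n) x \<le> C * (2 / 3) ^ n" for n
        proof -
          have "f n x \<le> ennreal C"
            using ennreal_suminf_lessD[of "\<lambda>n. f n x"] C(2) by (metis not_less order.irrefl)
          moreover have "f n x = ennreal ((3 / 2) ^ n * (pierce_T ^^ n) x)"
            using x False pierce_T_funpow_bounds[OF x, of n] by (simp add: f_def ennreal_mult)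
          ultimately have "(3 / 2) ^ n * (pierce_T ^^ n) x \<le> C"
            using C(1) by (simp add: ennreal_le_iff)
          thus ?thesis by (simp add: field_simps power_divide)
        qed
        thus ?thesis by blast
      qed
    qed
  qed
qed

theorem theorem1p1:
  "pierce_conv_exp \<in> {0..1} \<rightarrow> {0..1} \<and>
   (AE x in lebesgue_on {0..1}. pierce_conv_exp x = 0)"
proof
  show "pierce_conv_exp \<in> {0..1} \<rightarrow> {0..1}"
    using pierce_conv_exp_nonneg pierce_conv_exp_le_1 by auto
  have "AE x in lebesgue. x \<in> {0..1} \<longrightarrow> pierce_conv_exp x = 0"
    using AE_completion[OF AE_pierce_T_funpow_le]
  proof eventually_elim
    case (elim x)
    thus ?case using pierce_conv_exp_eq_0[of x "2 / 3"] by auto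
  qed
  thus "AE x in lebesgue_on {0..1}. pierce_conv_exp x = 0"
    by (subst AE_restrict_space_iff) auto
qed

end
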